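(* Let $\Delta$ be a unit-interval simplicial complex on the vertex set $[n]$, and let $\Gamma=\mathrm{Ind}(\Delta)$. Then for all $t\ge 1$, the facet ideal $I(\Gamma^{[t]})$ satisfies the $\ell$-exchange property with respect to the sorting order.
   Context: Let $S=K[x_1,\dots,x_n]$ over a field $K$; $\mathbf{x}_F=\prod_{i\in F}x_i$ for $F\subseteq[n]$. For a pure $(d-1)$-dimensional simplicial complex $\Delta$ on $[n]$: a clique is a subset $C\subseteq[n]$ all of whose $d$-subsets are facets of $\Delta$; $\mathrm{Ind}(\Delta)$ is the simplicial complex of all subsets of $[n]$ containing no facet of $\Delta$. $\Delta$ is a unit-interval simplicial complex if it is pure and for every facet $\{i_1<\cdots<i_d\}$ the interval $[i_1,i_d]=\{i_1,i_1+1,\dots,i_d\}$ is a clique of $\Delta$. For a simplicial complex $\Gamma$, $\Gamma^{[t]}$ is the simplicial complex generated by the faces of $\Gamma$ of dimension $t$ (i.e. cardinality $t+1$), and the facet ideal of a simplicial complex $\Lambda$ is $I(\Lambda)=(\mathbf{x}_F: F\text{ a facet of }\Lambda)\subseteq S$. Sorting: for monomials $u,v\in S$ write $uv=x_{i_1}\cdots x_{i_r}$ with $i_1\le\cdots\le i_r$, and set $\mathrm{sort}(u,v)=(u',v')$ with $u'=\prod_{j\text{ odd}}x_{i_j}$, $v'=\prod_{j\text{ even}}x_{i_j}$. For $\Gamma=\mathrm{Ind}(\Delta)$ as in the claim, the set $\mathcal G(I)$ of minimal monomial generators of $I=I(\Gamma^{[t]})$ is sortable, meaning $\mathrm{sort}(u,v)\in\mathcal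 G(I)\times\mathcal G(I)$ for all $u,v\in\mathcal G(I)$. For an equigenerated monomial ideal $I$, let $R=K[y_u:u\in\mathcal G(I)]$ and let $L$ be the kernel of the $K$-algebra map $R\to K[u:u\in\mathcal G(I)]$, $y_u\mapsto u$. If $\mathcal G(I)$ is sortable, a sorting order is a monomial order $<$ on $R$ for which the reduced Gröbner basis of $L$ consists of the binomials $y_uy_v-y_{u'}y_{v'}$, where $u,v\in\mathcal G(I)$, $(u',v')=\mathrm{sort}(u,v)$, $\{u',v'\}\ne\{u,v\}$, with initial term $y_uy_v$ (such an order exists by a theorem of Sturmfels). A monomial $w\in R$ is a standard monomial of $L$ with respect to $<$ if $w\notin\mathrm{in}_<(L)$. $\ell$-exchange property: $I$ satisfies the $\ell$-exchange property with respect to a monomial order $<$ on $R$ if the following holds: whenever $y_{u_1}\cdots y_{u_N}$ and $y_{v_1}\cdots y_{v_N}$ are two standard monomials of $L$ with respect to $<$ such that (i) $\deg_{x_r}(u_1\cdots u_N)=\deg_{x_r}(v_1\cdots v_N)$ for $r=1,\dots,q-1$ with $q\le n-1$, and (ii) $\deg_{x_q}(u_1\cdots u_N)<\deg_{x_q}(v_1\cdots v_N)$, then there exist an integer $k$ and an integer $q<j\le n$ such that $x_j$ divides $u_k$ and $x_qu_k/x_j\in I$. *)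

theory Defs
  imports "HOL-Library.Poly_Mapping" "HOL-Algebra.Ideal"
begin

section \<open>Simplicial complexes on \<open>[n]\<close>\<close>

text \<open>The void complex is admitted, since \<open>\<Gamma>\<^sup>[\<^sup>t\<^sup>]\<close> is void when \<open>\<Gamma>\<close> has no face of
  dimension \<open>t\<close>. Not every element of \<open>[n]\<close> has to be a face: an \<open>i\<close> lying in no facet
  would otherwise destroy purity.\<close>

definition simplicial_complex :: "nat \<Rightarrow> nat set set \<Rightarrow> bool" where
  "simplicial_complex n \<Delta> \<longleftrightarrow>
     (\<forall>F\<in>\<Delta>. F \<subseteq> {1..n}) \<and> (\<forall>F\<in>\<Delta>. \<forall>G. G \<subseteq> F \<longrightarrow> G \<in> \<Delta>)"

definition facets :: "nat set set \<Rightarrow> nat set set" where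
  "facets \<Delta> = {F \<in> \<Delta>. \<forall>G\<in>\<Delta>. F \<subseteq> G \<longrightarrow> G = F}"

text \<open>Pure of dimension \<open>d - 1\<close>.\<close>

definition pure_complex :: "nat \<Rightarrow> nat \<Rightarrow> nat set set \<Rightarrow> bool" where
  "pure_complex n d \<Delta> \<longleftrightarrow> simplicial_complex n \<Delta> \<and> (\<forall>F\<in>facets \<Delta>. card F = d)"

definition clique :: "nat \<Rightarrow> nat \<Rightarrow> nat set set \<Rightarrow> nat set \<Rightarrow> bool" where
  "clique n d \<Delta> C \<longleftrightarrow> C \<subseteq> {1..n} \<and> (\<forall>D. D \<subseteq> C \<and> card D = d \<longrightarrow> D \<in> facets \<Delta>)"

text \<open>The guard \<open>F \<noteq> {}\<close> only matters for the complex \<open>{{}}\<close>, where there is no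
  interval to consider.\<close>

definition unit_interval_complex :: "nat \<Rightarrow> nat \<Rightarrow> nat set set \<Rightarrow> bool" where
  "unit_interval_complex n d \<Delta> \<longleftrightarrow>
     pure_complex n d \<Delta> \<and> (\<forall>F\<in>facets \<Delta>. F \<noteq> {} \<longrightarrow> clique n d \<Delta> {Min F..Max F})"

definition independence_complex :: "nat \<Rightarrow> nat set set \<Rightarrow> nat set set" where
  "independence_complex n \<Delta> = {F. F \<subseteq> {1..n} \<and> (\<forall>G\<in>facets \<Delta>. \<not> G \<subseteq> F)}"

text \<open>\<open>\<Gamma>\<^sup>[\<^sup>t\<^sup>]\<close>: generated by the faces of dimension \<open>t\<close>, that is, of cardinality \<open>t + 1\<close>.\<close>

definition pure_skeleton :: "nat \<Rightarrow> nat set set \<Rightarrow> nat set set" where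
  "pure_skeleton t \<Gamma> = {F. \<exists>G\<in>\<Gamma>. card G = t + 1 \<and> F \<subseteq> G}"


section \<open>Polynomials\<close>

text \<open>Monomials are identified with their exponent vectors, of type \<open>'v monom\<close>; the
  product of monomials is the sum of exponent vectors. The type of polynomials has all elements
  of \<open>'v\<close> as variables, and \<open>poly_ring V\<close> is the subring \<open>K[V]\<close>.\<close>

type_synonym 'v monom = "'v \<Rightarrow>\<^sub>0 nat"
type_synonym ('v, 'k) mpoly = "'v monom \<Rightarrow>\<^sub>0 'k"

definition monomials :: "'v set \<Rightarrow> 'v monom set" where
  "monomials V = {m. Poly_Mapping.keys m \<subseteq> V}"

definition poly_ring :: "'v set \<Rightarrow> ('v, 'k::field) mpoly ring" where
  "poly_ring V =
     \<lparr>carrier = {p. Poly_Mapping.keys p \<subseteq> monomials V}, mult = (*), one = 1, zero = 0, add = (+)\<rparr>"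

definition mon_poly :: "'v monom \<Rightarrow> ('v, 'k::field) mpoly" where
  "mon_poly m = Poly_Mapping.single m 1"

definition var :: "'v \<Rightarrow> 'v monom" where
  "var v = Poly_Mapping.single v 1"

definition mon_dvd :: "'v monom \<Rightarrow> 'v monom \<Rightarrow> bool" where
  "mon_dvd a b \<longleftrightarrow> (\<exists>c. b = a + c)"

definition facet_ideal :: "nat \<Rightarrow> nat set set \<Rightarrow> (nat, 'k::field) mpoly set" where
  "facet_ideal n \<Lambda> =
     genideal (poly_ring {1..n}) {mon_poly (\<Sum>i\<in>F. var i) | F. F \<in> facets \<Lambda>}"

text \<open>\<open>\<G>(I)\<close> for a monomial ideal \<open>I\<close>.\<close>

definition min_gens :: "('v, 'k::field) mpoly set \<Rightarrow> 'v monom set" where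
  "min_gens I = {m. mon_poly m \<in> I \<and> (\<forall>m'. mon_poly m' \<in> I \<and> mon_dvd m' m \<longrightarrow> m' = m)}"


section \<open>Monomial orders and reduced Groebner bases\<close>

definition monomial_order ::
  "'v set \<Rightarrow> ('v monom \<Rightarrow> 'v monom \<Rightarrow> bool) \<Rightarrow> bool" where
  "monomial_order V lt \<longleftrightarrow>
     irreflp_on (monomials V) lt \<and> transp_on (monomials V) lt \<and> totalp_on (monomials V) lt \<and>
     (\<forall>m\<in>monomials V. m \<noteq> 0 \<longrightarrow> lt 0 m) \<and>
     (\<forall>a\<in>monomials V. \<forall>b\<in>monomials V. \<forall>c\<in>monomials V. lt a b \<longrightarrow> lt (a + c) (b + c))"

text \<open>Meaningful for nonzero \<open>p\<close>.\<close>

definition initial_mon ::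
  "('v monom \<Rightarrow> 'v monom \<Rightarrow> bool) \<Rightarrow> ('v, 'k::field) mpoly \<Rightarrow> 'v monom" where
  "initial_mon lt p = (THE m. m \<in> Poly_Mapping.keys p \<and>
     (\<forall>m'\<in>Poly_Mapping.keys p. m' \<noteq> m \<longrightarrow> lt m' m))"

definition initial_ideal ::
  "'v set \<Rightarrow> ('v monom \<Rightarrow> 'v monom \<Rightarrow> bool) \<Rightarrow>
     ('v, 'k::field) mpoly set \<Rightarrow> ('v, 'k) mpoly set" where
  "initial_ideal V lt J = genideal (poly_ring V) {mon_poly (initial_mon lt p) | p. p \<in> J \<and> p \<noteq> 0}"

definition groebner_basis ::
  "'v set \<Rightarrow> ('v monom \<Rightarrow> 'v monom \<Rightarrow> bool) \<Rightarrow>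
     ('v, 'k::field) mpoly set \<Rightarrow> ('v, 'k) mpoly set \<Rightarrow> bool" where
  "groebner_basis V lt J B \<longleftrightarrow>
     finite B \<and> 0 \<notin> B \<and> B \<subseteq> J \<and>
     genideal (poly_ring V) {mon_poly (initial_mon lt g) | g. g \<in> B} = initial_ideal V lt J"

definition reduced_groebner_basis ::
  "'v set \<Rightarrow> ('v monom \<Rightarrow> 'v monom \<Rightarrow> bool) \<Rightarrow>
     ('v, 'k::field) mpoly set \<Rightarrow> ('v, 'k) mpoly set \<Rightarrow> bool" where
  "reduced_groebner_basis V lt J B \<longleftrightarrow>
     groebner_basis V lt J B \<and>
     (\<forall>g\<in>B. Poly_Mapping.lookup g (initial_mon lt g) = 1) \<and>
     (\<forall>g\<in>B. \<forall>h\<in>B. g \<noteq> h \<longrightarrow> (\<forall>m\<in>Poly_Mapping.keys h. \<not> mon_dvd (initial_mon lt g) m))"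

definition standard_monomial ::
  "'v set \<Rightarrow> ('v monom \<Rightarrow> 'v monom \<Rightarrow> bool) \<Rightarrow>
     ('v, 'k::field) mpoly set \<Rightarrow> 'v monom \<Rightarrow> bool" where
  "standard_monomial V lt J w \<longleftrightarrow> w \<in> monomials V \<and> mon_poly w \<notin> initial_ideal V lt J"


section \<open>The toric ideal and sorting\<close>

text \<open>The variable \<open>y\<^sub>u\<close> of \<open>R = K[y\<^sub>u : u \<in> \<G>(I)]\<close> is indexed by the exponent vector of
  \<open>u\<close> itself, so \<open>R = poly_ring (min_gens I)\<close>.\<close>

text \<open>The \<open>K\<close>-algebra homomorphism sending each variable \<open>v\<close> to \<open>f v\<close>.\<close>

definition subst_hom ::
  "('v \<Rightarrow> ('w, 'k::field) mpoly) \<Rightarrow> ('v, 'k) mpoly \<Rightarrow> ('w, 'k) mpoly" where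
  "subst_hom f p =
     (\<Sum>m\<in>Poly_Mapping.keys p. Poly_Mapping.single 0 (Poly_Mapping.lookup p m) *
        (\<Prod>v\<in>Poly_Mapping.keys m. f v ^ Poly_Mapping.lookup m v))"

definition toric_ideal ::
  "(nat, 'k::field) mpoly set \<Rightarrow> (nat monom, 'k) mpoly set" where
  "toric_ideal I = {p \<in> carrier (poly_ring (min_gens I)). subst_hom mon_poly p = 0}"

text \<open>The list \<open>[i\<^sub>1, \<dots>, i\<^sub>r]\<close> with \<open>i\<^sub>1 \<le> \<dots> \<le> i\<^sub>r\<close> and \<open>m = x\<^bsub>i\<^sub>1\<^esub> \<dots> x\<^bsub>i\<^sub>r\<^esub>\<close>.\<close>

definition index_list :: "nat monom \<Rightarrow> nat list" where
  "index_list m =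
     concat (map (\<lambda>i. replicate (Poly_Mapping.lookup m i) i)
       (sorted_list_of_set (Poly_Mapping.keys m)))"

text \<open>List positions start at 0, so the odd places \<open>i\<^sub>1, i\<^sub>3, \<dots>\<close> are at even positions.\<close>

definition sort_mon ::
  "nat monom \<Rightarrow> nat monom \<Rightarrow> nat monom \<times> nat monom" where
  "sort_mon u v = (let l = index_list (u + v) in
     (\<Sum>j | j < length l \<and> even j. var (l ! j), \<Sum>j | j < length l \<and> odd j. var (l ! j)))"

definition unsorted :: "nat monom \<Rightarrow> nat monom \<Rightarrow> bool" where
  "unsorted u v \<longleftrightarrow> {fst (sort_mon u v), snd (sort_mon u v)} \<noteq> {u, v}"

definition sort_binomial ::
  "nat monom \<Rightarrow> nat monom \<Rightarrow> (nat monom, 'k::field) mpoly" where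
  "sort_binomial u v =
     mon_poly (var u + var v) - mon_poly (var (fst (sort_mon u v)) + var (snd (sort_mon u v)))"

text \<open>Sortability of \<open>\<G>(I)\<close> need not be demanded separately: a Groebner basis of \<open>L\<close> lies in
  \<open>R\<close>, so the binomials being one forces \<open>sort(u, v) \<in> \<G>(I) \<times> \<G>(I)\<close> for all
  \<open>u, v \<in> \<G>(I)\<close>.\<close>

definition sorting_order ::
  "(nat, 'k::field) mpoly set \<Rightarrow>
     (nat monom monom \<Rightarrow> nat monom monom \<Rightarrow> bool) \<Rightarrow> bool" where
  "sorting_order I lt \<longleftrightarrow>
     monomial_order (min_gens I) lt \<and>
     reduced_groebner_basis (min_gens I) lt (toric_ideal I)
       {sort_binomial u v | u v. u \<in> min_gens I \<and> v \<in> min_gens I \<and> unsorted u v} \<and>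
     (\<forall>u\<in>min_gens I. \<forall>v\<in>min_gens I. unsorted u v \<longrightarrow>
        initial_mon lt (sort_binomial u v :: (nat monom, 'k) mpoly) = var u + var v)"


section \<open>The l-exchange property\<close>

definition l_exchange_property ::
  "nat \<Rightarrow> (nat, 'k::field) mpoly set \<Rightarrow>
     (nat monom monom \<Rightarrow> nat monom monom \<Rightarrow> bool) \<Rightarrow> bool" where
  "l_exchange_property n I lt \<longleftrightarrow>
     (\<forall>N (u :: nat \<Rightarrow> nat monom) (v :: nat \<Rightarrow> nat monom) q.
        (\<forall>k\<in>{1..N}. u k \<in> min_gens I \<and> v k \<in> min_gens I) \<and>
        standard_monomial (min_gens I) lt (toric_ideal I) (\<Sum>k=1..N. var (u k)) \<and>
        standard_monomial (min_gens I) lt (toric_ideal I) (\<Sum>k=1..N. var (v k)) \<and>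
        1 \<le> q \<and> q \<le> n - 1 \<and>
        (\<forall>r. 1 \<le> r \<and> r \<le> q - 1 \<longrightarrow>
           Poly_Mapping.lookup (\<Sum>k=1..N. u k) r = Poly_Mapping.lookup (\<Sum>k=1..N. v k) r) \<and>
        Poly_Mapping.lookup (\<Sum>k=1..N. u k) q < Poly_Mapping.lookup (\<Sum>k=1..N. v k) q \<longrightarrow>
        (\<exists>k\<in>{1..N}. \<exists>j. q < j \<and> j \<le> n \<and> mon_dvd (var j) (u k) \<and>
           mon_poly (var q + u k - var j) \<in> I))"

end

theory Submission
  imports Defs "HOL-Library.Multiset"
begin

text \<open>The factors of a standard monomial are pairwise sorted, so they can be numbered such that,
  for every \<open>r\<close>, the numbers of their indices \<open>\<le> r\<close> form a nonincreasing sequence with spread at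
  most 1. Such a sequence is determined by its length and its sum. Hence, after renumbering,
  \<open>u\<^sub>k\<close> and \<open>v\<^sub>k\<close> have the same indices below \<open>q\<close>, and for some \<open>k\<close> the index \<open>q\<close> occurs
  in \<open>v\<^sub>k\<close> but not in \<open>u\<^sub>k\<close>. Let \<open>j\<close> be the least index of \<open>u\<^sub>k\<close> above \<open>q\<close>. A facet contained in
  the support of \<open>x\<^sub>q u\<^sub>k / x\<^sub>j\<close> contains \<open>q\<close>. If it has no vertex above \<open>q\<close>, it lies in the support
  of \<open>v\<^sub>k\<close>; otherwise the clique on its interval allows \<open>q\<close> to be replaced by \<open>j\<close>, which gives
  a facet in the support of \<open>u\<^sub>k\<close>. Both are impossible.\<close>

section \<open>Monomials and monomial ideals\<close>

abbreviation squarefree_mon :: "nat set \<Rightarrow> nat monom" where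
  "squarefree_mon F \<equiv> (\<Sum>i\<in>F. var i)"

lemma lookup_var: "Poly_Mapping.lookup (var v) w = (if w = v then 1 else 0)"
  by (simp add: var_def lookup_single when_def)

lemma lookup_sum_monom:
  "Poly_Mapping.lookup (\<Sum>k\<in>A. (f k :: 'v monom)) r = (\<Sum>k\<in>A. Poly_Mapping.lookup (f k) r)"
  by (induction A rule: infinite_finite_induct) (auto simp: lookup_add)

lemma lookup_squarefree_mon:
  "finite F \<Longrightarrow> Poly_Mapping.lookup (squarefree_mon F) s = (if s \<in> F then 1 else 0)"
  by (simp add: lookup_sum_monom lookup_var)

lemma keys_mon_poly [simp]: "Poly_Mapping.keys (mon_poly m :: ('v, 'k::field) mpoly) = {m}"
  by (simp add: mon_poly_def)

lemma mon_poly_add: "mon_poly (a + b) = (mon_poly a * mon_poly b :: ('v, 'k::field) mpoly)"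
  by (simp add: mon_poly_def mult_single)

lemma mon_dvd_add: "mon_dvd a b \<Longrightarrow> mon_dvd a (b + c)"
  unfolding mon_dvd_def by (metis add.assoc)

lemma mon_dvd_refl: "mon_dvd a a"
  unfolding mon_dvd_def by (rule exI[of _ 0]) simp

lemma monomials_zero: "0 \<in> monomials V"
  by (simp add: monomials_def)

lemma monomials_add: "a \<in> monomials V \<Longrightarrow> b \<in> monomials V \<Longrightarrow> a + b \<in> monomials V"
  unfolding monomials_def using Poly_Mapping.keys_add[of a b] by auto

section \<open>The ring \<open>poly_ring V\<close> and membership of monomials in ideals generated
  by monomials\<close>

lemma carrier_poly_ring: "carrier (poly_ring V) = {p. Poly_Mapping.keys p \<subseteq> monomials V}"
  by (simp add: poly_ring_def)

lemma carrier_poly_ring_mult: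
  assumes "p \<in> carrier (poly_ring V)" "q \<in> carrier (poly_ring V)"
  shows "p * q \<in> carrier (poly_ring V)"
proof -
  have "m \<in> monomials V" if "m \<in> Poly_Mapping.keys (p * q)" for m
    using that keys_mult[of p q] assms monomials_add[of _ V] unfolding carrier_poly_ring by blast
  then show ?thesis by (auto simp: carrier_poly_ring)
qed

lemma ring_poly_ring: "ring (poly_ring V :: ('v, 'k::field) mpoly ring)"
proof (rule ringI)
  show "abelian_group (poly_ring V :: ('v, 'k) mpoly ring)"
  proof (rule abelian_groupI)
    fix x :: "('v, 'k) mpoly" assume "x \<in> carrier (poly_ring V)"
    then show "\<exists>y\<in>carrier (poly_ring V). y \<oplus>\<^bsub>poly_ring V\<^esub> x = \<zero>\<^bsub>poly_ring V\<^esub>"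
      by (intro bexI[of _ "- x"]) (auto simp: poly_ring_def)
  next
    fix x y :: "('v, 'k) mpoly"
    assume "x \<in> carrier (poly_ring V)" "y \<in> carrier (poly_ring V)"
    then show "x \<oplus>\<^bsub>poly_ring V\<^esub> y \<in> carrier (poly_ring V)"
      using Poly_Mapping.keys_add[of x y] by (auto simp: poly_ring_def)
  qed (auto simp: poly_ring_def algebra_simps)
  show "monoid (poly_ring V :: ('v, 'k) mpoly ring)"
  proof (rule monoidI)
    fix x y :: "('v, 'k) mpoly"
    assume "x \<in> carrier (poly_ring V)" "y \<in> carrier (poly_ring V)"
    then show "x \<otimes>\<^bsub>poly_ring V\<^esub> y \<in> carrier (poly_ring V)"
      using carrier_poly_ring_mult[of x V y] by (simp add: poly_ring_def)
  qed (auto simp: poly_ring_def algebra_simps monomials_zero)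
qed (auto simp: poly_ring_def algebra_simps)

text \<open>This ideal bounds from above the one generated by the monomials in \<open>G\<close>.
  Absorption holds because every monomial of a product \<open>x * a\<close> is a monomial of
  \<open>x\<close> times one of \<open>a\<close>, and the latter already has a divisor in
  \<open>G\<close>.\<close>

lemma ideal_monomial_multiples:
  "ideal {p \<in> carrier (poly_ring V). \<forall>m\<in>Poly_Mapping.keys p. \<exists>g\<in>G. mon_dvd g m}
     (poly_ring V :: ('v, 'k::field) mpoly ring)"
  (is "ideal ?J ?R")
proof (rule idealI[OF ring_poly_ring])
  interpret ring ?R by (rule ring_poly_ring)
  show "subgroup ?J (add_monoid ?R)"
  proof (rule group.subgroupI)
    show "group (add_monoid ?R)" by (rule a_group)
    show "?J \<noteq> {}" by (auto simp: poly_ring_def intro!: exI[of _ 0])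
  next
    fix a b assume "a \<in> ?J" "b \<in> ?J"
    then show "a \<otimes>\<^bsub>add_monoid ?R\<^esub> b \<in> ?J"
      using Poly_Mapping.keys_add[of a b] by (auto simp: poly_ring_def)
  next
    fix a assume a: "a \<in> ?J"
    have "- a = inv\<^bsub>add_monoid ?R\<^esub> a"
      using a by (intro group.inv_equality[OF a_group, symmetric]) (auto simp: poly_ring_def)
    moreover have "- a \<in> ?J" using a by (simp add: carrier_poly_ring)
    ultimately show "inv\<^bsub>add_monoid ?R\<^esub> a \<in> ?J" by (simp only:)
  qed auto
  have mult: "x * a \<in> ?J" if "a \<in> ?J" "x \<in> carrier ?R" for a x
  proof -
    have "\<exists>g\<in>G. mon_dvd g m" if "m \<in> Poly_Mapping.keys (x * a)" for m
    proof -
      obtain b c where "m = c + b" "b \<in> Poly_Mapping.keys a"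
        using \<open>m \<in> _\<close> keys_mult[of x a] by blast
      moreover obtain g where "g \<in> G" "mon_dvd g b"
        using \<open>a \<in> ?J\<close> \<open>b \<in> _\<close> by blast
      ultimately show ?thesis
        using mon_dvd_add[of g b c] by (auto simp: add.commute)
    qed
    then show ?thesis using that carrier_poly_ring_mult[of x V a] by auto
  qed
  show "x \<otimes>\<^bsub>?R\<^esub> a \<in> ?J" "a \<otimes>\<^bsub>?R\<^esub> x \<in> ?J" if "a \<in> ?J" "x \<in> carrier ?R" for a x
    using mult[OF that] by (simp_all add: poly_ring_def mult.commute)
qed

text \<open>The generated ideal is the intersection of all ideals containing the generators, so it
  lies in the ideal of polynomials all of whose monomials have a divisor in \<open>G\<close>. The
  only monomial of \<open>mon_poly m\<close> is \<open>m\<close>.\<close>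

lemma mon_poly_in_genidealD:
  fixes G :: "'v monom set"
  assumes "mon_poly m \<in> genideal (poly_ring V :: ('v, 'k::field) mpoly ring) (mon_poly ` G)"
    and "G \<subseteq> monomials V"
  shows "\<exists>g\<in>G. mon_dvd g m"
proof -
  have "mon_poly ` G \<subseteq> {p \<in> carrier (poly_ring V :: ('v, 'k) mpoly ring).
      \<forall>m\<in>Poly_Mapping.keys p. \<exists>g\<in>G. mon_dvd g m}"
    using assms(2) by (auto simp: carrier_poly_ring intro: mon_dvd_refl)
  then have "mon_poly m \<in> {p \<in> carrier (poly_ring V :: ('v, 'k) mpoly ring).
      \<forall>m\<in>Poly_Mapping.keys p. \<exists>g\<in>G. mon_dvd g m}"
    using assms(1) ideal_monomial_multiples[of V G] unfolding genideal_def by blast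
  then show ?thesis by simp
qed

lemma genideal_superset: "S \<subseteq> genideal R S"
  unfolding genideal_def by blast

lemma genideal_mult_mon_poly:
  fixes S :: "('v, 'k::field) mpoly set"
  assumes "mon_poly a \<in> S" "c \<in> monomials V"
  shows "mon_poly (c + a) \<in> genideal (poly_ring V) S"
  unfolding genideal_def
proof safe
  fix J assume J: "ideal J (poly_ring V :: ('v, 'k) mpoly ring)" "S \<subseteq> J"
  have "mon_poly c \<otimes>\<^bsub>poly_ring V\<^esub> mon_poly a \<in> J"
    using J assms by (intro ideal.I_l_closed[OF J(1)]) (auto simp: carrier_poly_ring)
  then show "mon_poly (c + a) \<in> J" by (simp add: poly_ring_def mon_poly_add)
qed

section \<open>Generators of the facet ideal\<close>

lemma facets_pure_skeleton:
  "facets (pure_skeleton t (independence_complex n \<Delta>)) =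
     {F \<in> independence_complex n \<Delta>. card F = t + 1}" (is "facets ?S = ?B")
proof (intro equalityI subsetI)
  fix F assume F: "F \<in> facets ?S"
  then obtain G where G: "G \<in> ?B" "F \<subseteq> G"
    unfolding facets_def pure_skeleton_def by blast
  then have "G \<in> ?S" unfolding pure_skeleton_def by blast
  then have "G = F" using F G(2) unfolding facets_def by blast
  then show "F \<in> ?B" using G(1) by simp
next
  fix F assume F: "F \<in> ?B"
  have "G' = F" if "G' \<in> ?S" "F \<subseteq> G'" for G'
  proof -
    from \<open>G' \<in> ?S\<close> obtain G where G: "card G = t + 1" "G' \<subseteq> G"
      unfolding pure_skeleton_def by blast
    \<comment> \<open>Infinite sets have \<open>card\<close> 0, so the positive cardinality
      \<open>t + 1\<close> gives finiteness; inclusion together with equal cardinality is then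
      equality.\<close>
    have "finite G" using G(1) by (intro card_ge_0_finite) simp
    then have "F = G" using card_subset_eq[of G F] F G \<open>F \<subseteq> G'\<close> by auto
    then show ?thesis using G(2) \<open>F \<subseteq> G'\<close> by blast
  qed
  moreover have "F \<in> ?S" using F unfolding pure_skeleton_def by blast
  ultimately show "F \<in> facets ?S" unfolding facets_def by blast
qed

lemma independence_complex_finite: "F \<in> independence_complex n \<Delta> \<Longrightarrow> finite F"
  by (auto simp: independence_complex_def intro: finite_subset)

lemma facet_ideal_eq:
  "facet_ideal n \<Lambda> =
     (genideal (poly_ring {1..n}) (mon_poly ` squarefree_mon ` facets \<Lambda>) :: (nat, 'k::field) mpoly set)"
proof -
  have "{mon_poly (squarefree_mon F) | F. F \<in> facets \<Lambda>} =
      (mon_poly ` squarefree_mon ` facets \<Lambda> :: (nat, 'k) mpoly set)"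
    by blast
  then show ?thesis unfolding facet_ideal_def by (simp only:)
qed

lemma squarefree_mon_in_facet_ideal:
  "F \<in> facets \<Lambda> \<Longrightarrow> mon_poly (squarefree_mon F) \<in> facet_ideal n \<Lambda>"
  unfolding facet_ideal_eq by (intro subsetD[OF genideal_superset] imageI)

text \<open>Any monomial of the ideal is divisible by some facet monomial, which itself lies in the
  ideal; minimality makes the two equal.\<close>

lemma min_gens_facet_ideal:
  assumes "\<And>F. F \<in> facets \<Lambda> \<Longrightarrow> F \<subseteq> {1..n}"
  shows "min_gens (facet_ideal n \<Lambda> :: (nat, 'k::field) mpoly set) \<subseteq> squarefree_mon ` facets \<Lambda>"
proof
  fix m assume m: "m \<in> min_gens (facet_ideal n \<Lambda> :: (nat, 'k) mpoly set)"
  have "squarefree_mon ` facets \<Lambda> \<subseteq> monomials {1..n}"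
  proof safe
    fix F assume "F \<in> facets \<Lambda>"
    with assms[OF this] show "squarefree_mon F \<in> monomials {1..n}"
      using finite_subset[of F "{1..n}"]
      by (auto simp: monomials_def in_keys_iff lookup_squarefree_mon split: if_splits)
  qed
  moreover have "mon_poly m \<in> (facet_ideal n \<Lambda> :: (nat, 'k) mpoly set)"
    using m unfolding min_gens_def by blast
  ultimately obtain F where F: "F \<in> facets \<Lambda>" "mon_dvd (squarefree_mon F) m"
    unfolding facet_ideal_eq by (blast dest: mon_poly_in_genidealD)
  have "mon_poly (squarefree_mon F) \<in> (facet_ideal n \<Lambda> :: (nat, 'k) mpoly set)"
    by (rule squarefree_mon_in_facet_ideal) fact
  then have "squarefree_mon F = m" using m F(2) unfolding min_gens_def by blast
  then show "m \<in> squarefree_mon ` facets \<Lambda>" using F(1) by blast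
qed

section \<open>Sorted families\<close>

text \<open>Cumulative exponents determine the monomial and turn sorting into arithmetic: each count
  of the product is halved, once rounded up and once rounded down.\<close>

definition index_count :: "nat monom \<Rightarrow> nat \<Rightarrow> nat" where
  "index_count m r = (\<Sum>s\<le>r. Poly_Mapping.lookup m s)"

lemma index_count_sum: "index_count (\<Sum>k\<in>A. f k) r = (\<Sum>k\<in>A. index_count (f k) r)"
  unfolding index_count_def lookup_sum_monom by (rule sum.swap)

lemma index_count_var: "index_count (var i) r = (if i \<le> r then 1 else 0)"
  by (simp add: index_count_def lookup_var)

lemma index_count_squarefree_mon:
  assumes "finite F"
  shows "index_count (squarefree_mon F) r = card {i \<in> F. i \<le> r}"
  using assms by (simp add: index_count_sum index_count_var sum.If_cases Int_def)

section \<open>Cumulative counts of a sorted pair\<close>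

lemma sorted_index_list: "sorted (index_list m)"
proof -
  have "sorted (concat (map (\<lambda>i. replicate (f i) i) xs))" if "sorted xs" for f and xs :: "nat list"
    using that by (induction xs) (auto simp: sorted_append)
  then show ?thesis unfolding index_list_def by simp
qed

lemma card_even_less: "card {j. j < M \<and> even j} = (M + 1) div (2::nat)"
proof (induction M)
  case (Suc M)
  have "{j. j < Suc M \<and> even j} = {j. j < M \<and> even j} \<union> (if even M then {M} else {})"
    by (auto simp: less_Suc_eq)
  then have "card {j. j < Suc M \<and> even j} = (M + 1) div 2 + (if even M then 1 else 0)"
    by (simp add: card_insert_if Suc)
  then show ?case by (cases "even M"; simp; presburger)
qed simp

lemma card_odd_less: "card {j. j < M \<and> odd j} = M div (2::nat)"
proof (induction M)
  case (Suc M)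
  have "{j. j < Suc M \<and> odd j} = {j. j < M \<and> odd j} \<union> (if odd M then {M} else {})"
    by (auto simp: less_Suc_eq)
  then have "card {j. j < Suc M \<and> odd j} = M div 2 + (if odd M then 1 else 0)"
    by (simp add: card_insert_if Suc)
  then show ?case by (cases "even M"; simp; presburger)
qed simp

text \<open>In the sorted index list of \<open>u + v\<close> the entries \<le> \<open>r\<close> fill
  an initial segment of some length \<open>M\<close>. With positions counted from 0, the first
  monomial receives its even positions and the second its odd ones.\<close>

lemma index_count_sort_mon:
  "\<exists>M. index_count (fst (sort_mon u v)) r = (M + 1) div 2 \<and>
       index_count (snd (sort_mon u v)) r = M div 2"
proof -
  define l where "l = index_list (u + v)"
  have sl: "sorted l" unfolding l_def by (rule sorted_index_list)
  define M where "M = length (takeWhile (\<lambda>x. x \<le> r) l)"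
  have M: "j < length l \<and> l ! j \<le> r \<longleftrightarrow> j < M" for j
  proof
    assume j: "j < length l \<and> l ! j \<le> r"
    show "j < M"
    proof (rule ccontr)
      assume "\<not> j < M"
      then have "M \<le> j" "M < length l" using j by auto
      then have "\<not> l ! M \<le> r" using nth_length_takeWhile[of "\<lambda>x. x \<le> r" l] by (simp add: M_def)
      moreover have "l ! M \<le> l ! j" using sorted_nth_mono[OF sl \<open>M \<le> j\<close>] j by simp
      ultimately show False using j by simp
    qed
  next
    assume j: "j < M"
    then have "takeWhile (\<lambda>x. x \<le> r) l ! j = l ! j" "j < length l"
      using length_takeWhile_le[of "\<lambda>x. x \<le> r" l] by (auto simp: M_def takeWhile_nth)
    then show "j < length l \<and> l ! j \<le> r"
      using j set_takeWhileD[of "l ! j" "\<lambda>x. x \<le> r" l] nth_mem[of j "takeWhile (\<lambda>x. x \<le> r) l"]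
      by (auto simp: M_def)
  qed
  \<comment> \<open>This is the shape in which \<open>sum.If_cases\<close> leaves the positions that
    contribute 1 to the count.\<close>
  have eq: "{j. j < length l \<and> P j} \<inter> {j. l ! j \<le> r} = {j. j < M \<and> P j}" for P
    using M by blast
  have "index_count (\<Sum>j | j < length l \<and> P j. var (l ! j)) r = card {j. j < M \<and> P j}" for P
    unfolding index_count_sum index_count_var by (subst sum.If_cases) (auto simp: eq)
  then show ?thesis
    unfolding sort_mon_def Let_def l_def[symmetric] by (auto simp: card_even_less card_odd_less)
qed

text \<open>The trace of sortedness of the ordered pair on cumulative counts. The relation is not
  transitive, since two differences of 1 can add up to 2; pairwise comparability of a family
  therefore has to be kept as such.\<close>

definition precedes :: "nat monom \<Rightarrow> nat monom \<Rightarrow> bool" where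
  "precedes u v \<longleftrightarrow>
     (\<forall>r. index_count v r \<le> index_count u r \<and> index_count u r \<le> index_count v r + 1)"

text \<open>The output of \<open>sort_mon\<close> always satisfies \<open>precedes\<close>, as
  rounding up and rounding down differ by at most 1. A pair that is not \<open>unsorted\<close> is
  this output up to swapping, whence the disjunction.\<close>

lemma not_unsorted_precedes:
  assumes "\<not> unsorted u v"
  shows "precedes u v \<or> precedes v u"
proof -
  have "precedes (fst (sort_mon u v)) (snd (sort_mon u v))"
    unfolding precedes_def
  proof
    fix r
    obtain M where "index_count (fst (sort_mon u v)) r = (M + 1) div 2"
       "index_count (snd (sort_mon u v)) r = M div 2" using index_count_sort_mon by blast
    then show "index_count (snd (sort_mon u v)) r \<le> index_count (fst (sort_mon u v)) r \<and>
      index_count (fst (sort_mon u v)) r \<le> index_count (snd (sort_mon u v)) r + 1" by auto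
  qed
  moreover have "{fst (sort_mon u v), snd (sort_mon u v)} = {u, v}"
    using assms by (simp add: unsorted_def)
  ultimately show ?thesis by (metis doubleton_eq_iff)
qed

text \<open>For an unsorted pair of factors, the product of their two variables is the initial
  monomial of a Groebner basis element. It divides the whole product, which would then lie in the
  initial ideal.\<close>

lemma standard_monomial_sorted:
  fixes I :: "(nat, 'k::field) mpoly set" and u :: "nat \<Rightarrow> nat monom"
  assumes so: "sorting_order I lt"
    and st: "standard_monomial (min_gens I) lt (toric_ideal I) (\<Sum>k\<in>K. var (u k))"
    and fin: "finite K"
    and gens: "\<And>k. k \<in> K \<Longrightarrow> u k \<in> min_gens I"
    and k: "k \<in> K" "l \<in> K" "k \<noteq> l"
  shows "\<not> unsorted (u k) (u l)"
proof
  assume un: "unsorted (u k) (u l)"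
  define b :: "(nat monom, 'k) mpoly" where "b = sort_binomial (u k) (u l)"
  let ?B = "{sort_binomial u v | u v. u \<in> min_gens I \<and> v \<in> min_gens I \<and> unsorted u v}
    :: (nat monom, 'k) mpoly set"
  have "reduced_groebner_basis (min_gens I) lt (toric_ideal I) ?B"
    using so unfolding sorting_order_def by (elim conjE)
  then have "?B \<subseteq> toric_ideal I" "0 \<notin> ?B"
    unfolding reduced_groebner_basis_def groebner_basis_def by simp_all
  moreover have "b \<in> ?B" unfolding b_def using un gens k by blast
  ultimately have b: "b \<in> toric_ideal I" "b \<noteq> 0" by (blast, metis)
  have ini: "initial_mon lt b = var (u k) + var (u l)"
    using so un gens k unfolding sorting_order_def b_def by (elim conjE) simp
  \<comment> \<open>The cofactor: the product of the variables at all remaining positions. It must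
    be a monomial of \<open>poly_ring (min_gens I)\<close> for the ideal to absorb it.\<close>
  define c where "c = (\<Sum>i\<in>K - {k, l}. var (u i))"
  have "Poly_Mapping.lookup c w = 0" if "w \<notin> min_gens I" for w
    unfolding c_def lookup_sum_monom using that gens by (intro sum.neutral) (auto simp: lookup_var)
  then have "c \<in> monomials (min_gens I)" by (auto simp: monomials_def in_keys_iff)
  then have "mon_poly (c + (var (u k) + var (u l))) \<in> initial_ideal (min_gens I) lt (toric_ideal I)"
    unfolding initial_ideal_def ini[symmetric] using b by (intro genideal_mult_mon_poly) blast
  moreover have "(\<Sum>i\<in>K. var (u i)) = c + (var (u k) + var (u l))"
    using k fin sum.subset_diff[of "{k, l}" K "\<lambda>i. var (u i)"] unfolding c_def by simp
  ultimately show False using st by (simp add: standard_monomial_def)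
qed

text \<open>Since \<open>precedes\<close> is not transitive, the family is sorted by a numerical key
  instead, and pairwise comparability then gives \<open>precedes\<close> for all pairs in the new
  order. Being a permutation, the new family has the same sums; multiplicities are kept.\<close>

lemma sorted_family_arrangement:
  fixes u :: "nat \<Rightarrow> nat monom"
  assumes "\<And>k l. k \<in> {1..N} \<Longrightarrow> l \<in> {1..N} \<Longrightarrow> k \<noteq> l \<Longrightarrow> precedes (u k) (u l) \<or> precedes (u l) (u k)"
    and "\<And>k r. k \<in> {1..N} \<Longrightarrow> n \<le> r \<Longrightarrow> index_count (u k) r = index_count (u k) n"
  obtains w where "\<And>i. i < N \<Longrightarrow> w i \<in> u ` {1..N}"
    "\<And>f :: nat monom \<Rightarrow> nat. (\<Sum>i<N. f (w i)) = (\<Sum>k=1..N. f (u k))"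
    "\<forall>j<N. \<forall>i\<le>j. precedes (w i) (w j)"
proof -
  \<comment> \<open>The sign is negative because \<open>sort_key\<close> is ascending while larger
    counts must come first. Stopping at \<open>n\<close> keeps the sum finite.\<close>
  define S where "S m = - int (\<Sum>r\<le>n. index_count m r)" for m
  define ws where "ws = sort_key S (map u [1..<Suc N])"
  have len: "length ws = N" by (simp add: ws_def)
  have set: "set ws = u ` {1..N}" by (simp add: ws_def atLeastLessThanSuc_atLeastAtMost del: upt_Suc)
  show thesis
  proof (rule that[of "(!) ws"])
    show mem: "ws ! i \<in> u ` {1..N}" if "i < N" for i
      using that len set nth_mem by metis
    show "(\<Sum>i<N. f (ws ! i)) = (\<Sum>k=1..N. f (u k))" for f :: "nat monom \<Rightarrow> nat"
    proof -
      have "(\<Sum>i<N. f (ws ! i)) = sum_list (map f ws)"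
        by (simp add: sum_list_sum_nth len atLeast0LessThan)
      also have "\<dots> = sum_mset (image_mset f (mset ws))" by (simp add: sum_mset_sum_list flip: mset_map)
      also have "\<dots> = sum_mset (image_mset f (mset (map u [1..<Suc N])))" by (simp add: ws_def)
      also have "\<dots> = sum_list (map (\<lambda>k. f (u k)) [1..<Suc N])"
        by (simp add: sum_mset_sum_list o_def flip: mset_map del: upt_Suc)
      also have "\<dots> = (\<Sum>k=1..N. f (u k))"
        by (simp add: interv_sum_list_conv_sum_set_nat atLeastLessThanSuc_atLeastAtMost del: upt_Suc)
      finally show ?thesis .
    qed
    show "\<forall>j<N. \<forall>i\<le>j. precedes (ws ! i) (ws ! j)"
    proof (intro allI impI)
      fix i j assume ij: "j < N" "i \<le> j"
      have "sorted (map S ws)" by (simp add: ws_def)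
      then have le: "S (ws ! i) \<le> S (ws ! j)"
        using sorted_nth_mono[of "map S ws" i j] ij len by simp
      obtain k l where kl: "k \<in> {1..N}" "l \<in> {1..N}" "ws ! i = u k" "ws ! j = u l"
        using mem[of i] mem[of j] ij by auto
      show "precedes (ws ! i) (ws ! j)"
      proof (rule ccontr)
        assume not: "\<not> precedes (ws ! i) (ws ! j)"
        \<comment> \<open>\<open>precedes\<close> is reflexive, so its failure forces distinct
          monomials, hence \<open>k\<close> \<noteq> \<open>l\<close>, and comparability leaves only
          the reverse relation.\<close>
        have ne: "ws ! i \<noteq> ws ! j" using not by (auto simp: precedes_def)
        then have pr: "precedes (ws ! j) (ws ! i)" using assms(1)[of k l] kl not by auto
        have "\<exists>r. index_count (ws ! i) r \<noteq> index_count (ws ! j) r"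
          using not unfolding precedes_def by (metis order_refl le_add1)
        then obtain r where r: "index_count (ws ! i) r \<noteq> index_count (ws ! j) r" by blast
        \<comment> \<open>The key only sees counts up to \<open>n\<close>; beyond \<open>n\<close>
          they are constant, so a difference there already shows at \<open>n\<close>.\<close>
        have "\<exists>r\<le>n. index_count (ws ! i) r \<noteq> index_count (ws ! j) r"
        proof (cases "r \<le> n")
          case False
          then show ?thesis using r kl assms(2)[of k r] assms(2)[of l r] by auto
        qed (use r in blast)
        then obtain r' where "r' \<le> n" "index_count (ws ! i) r' \<noteq> index_count (ws ! j) r'" by blast
        then have "(\<Sum>r\<le>n. index_count (ws ! i) r) < (\<Sum>r\<le>n. index_count (ws ! j) r)"
          using pr unfolding precedes_def
          by (intro sum_strict_mono_ex1) (auto intro!: bexI[of _ r'] simp: less_le)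
        then show False using le by (simp add: S_def flip: of_nat_sum)
      qed
    qed
  qed
qed

text \<open>Suppose \<open>a i > b i\<close>. For \<open>j\<close> \<le> \<open>i\<close>,
  \<open>a j\<close> \<ge> \<open>a i\<close> \<ge> \<open>b i + 1\<close> \<ge> \<open>b j\<close>;
  for \<open>j\<close> \<ge> \<open>i\<close>, \<open>a j\<close> \<ge> \<open>a i - 1\<close> \<ge>
  \<open>b i\<close> \<ge> \<open>b j\<close>. So \<open>a\<close> dominates \<open>b\<close>
  everywhere, strictly at \<open>i\<close>, against the comparison of sums.\<close>

lemma balanced_sequence_mono:
  fixes a b :: "nat \<Rightarrow> nat"
  assumes a: "\<And>i j. i \<le> j \<Longrightarrow> j < N \<Longrightarrow> a j \<le> a i \<and> a i \<le> a j + 1"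
    and b: "\<And>i j. i \<le> j \<Longrightarrow> j < N \<Longrightarrow> b j \<le> b i \<and> b i \<le> b j + 1"
    and le: "(\<Sum>i<N. a i) \<le> (\<Sum>i<N. b i)"
    and i: "i < N"
  shows "a i \<le> b i"
proof (rule ccontr)
  assume lt: "\<not> a i \<le> b i"
  have "b j \<le> a j" if "j < N" for j
    using a[of i j] a[of j i] b[of i j] b[of j i] that i lt by linarith
  then have "(\<Sum>i<N. b i) < (\<Sum>i<N. a i)"
    using lt i by (intro sum_strict_mono_ex1) (auto intro!: bexI[of _ i])
  then show False using le by simp
qed

section \<open>The exchange\<close>

lemma independence_complex_exchange:
  assumes ui: "unit_interval_complex n d \<Delta>"
    and F: "F \<in> independence_complex n \<Delta>" and G: "G \<in> independence_complex n \<Delta>"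
    and below: "\<And>s. s < q \<Longrightarrow> s \<in> F \<longleftrightarrow> s \<in> G"
    and q: "q \<in> G" "q \<notin> F"
    and j: "j \<in> F" "q < j" "\<And>s. s \<in> F \<Longrightarrow> q < s \<Longrightarrow> j \<le> s"
  shows "insert q (F - {j}) \<in> independence_complex n \<Delta>"
proof -
  have F1: "F \<subseteq> {1..n}" "\<not> H \<subseteq> F" if "H \<in> facets \<Delta>" for H
    using F that by (auto simp: independence_complex_def)
  have "\<not> H \<subseteq> insert q (F - {j})" if H: "H \<in> facets \<Delta>" for H
  proof
    assume sub: "H \<subseteq> insert q (F - {j})"
    \<comment> \<open>Without \<open>q\<close>, the facet \<open>H\<close> would lie inside the
      independent set \<open>F\<close>.\<close>
    have qH: "q \<in> H" using sub F1[OF H] by auto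
    have "H \<subseteq> {1..n}" and cardH: "card H = d"
      using ui H
      unfolding unit_interval_complex_def pure_complex_def simplicial_complex_def facets_def by auto
    then have fin: "finite H" using finite_subset by auto
    show False
    proof (cases "\<forall>s\<in>H. s \<le> q")
      case True
      have "H \<subseteq> G"
      proof
        fix s assume s: "s \<in> H"
        then have "s = q \<or> s < q \<and> s \<in> F" using sub True by force
        then show "s \<in> G" using below q by auto
      qed
      then show False using G H by (auto simp: independence_complex_def)
    next
      case False
      then obtain s where s: "s \<in> H" "q < s" by auto
      \<comment> \<open>As \<open>s\<close> exceeds \<open>q\<close>, it comes from
        \<open>F\<close>, so minimality of \<open>j\<close> applies. Hence \<open>j\<close> lies
        between two vertices of \<open>H\<close> and belongs to its interval.\<close>
      then have "j \<le> s" using sub j(3) by auto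
      have jH: "j \<notin> H" using sub j by auto
      have "clique n d \<Delta> {Min H..Max H}"
        using ui H qH unfolding unit_interval_complex_def by auto
      moreover have "insert j (H - {q}) \<subseteq> {Min H..Max H}"
      proof -
        have "Min H \<le> q" "s \<le> Max H" using fin qH s by auto
        then show ?thesis using fin \<open>j \<le> s\<close> j(2) by auto
      qed
      moreover have "card (insert j (H - {q})) = d"
        using fin jH qH cardH card_gt_0_iff[of H] by (auto simp: card_insert_if)
      ultimately have "insert j (H - {q}) \<in> facets \<Delta>" unfolding clique_def by blast
      moreover have "insert j (H - {q}) \<subseteq> F" using sub j by auto
      ultimately show False using F1 by blast
    qed
  qed
  then show ?thesis using F G q by (auto simp: independence_complex_def)
qed

text \<open>For \<open>r < q\<close> the cumulative counts of both families have equal totals, so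
  comparing balanced sequences in both directions makes them equal term by term. Exponents below
  \<open>q\<close> are differences of consecutive counts and agree as well. The strict inequality of
  totals at \<open>q\<close> is witnessed by some single \<open>i\<close>.\<close>

lemma sorted_families_first_difference:
  fixes u v :: "nat \<Rightarrow> nat monom"
  assumes u: "\<forall>j<N. \<forall>i\<le>j. precedes (u i) (u j)"
    and v: "\<forall>j<N. \<forall>i\<le>j. precedes (v i) (v j)"
    and eq: "\<And>r. r < q \<Longrightarrow> (\<Sum>i<N. Poly_Mapping.lookup (u i) r) = (\<Sum>i<N. Poly_Mapping.lookup (v i) r)"
    and less: "(\<Sum>i<N. Poly_Mapping.lookup (u i) q) < (\<Sum>i<N. Poly_Mapping.lookup (v i) q)"
  obtains i where "i < N" "\<And>s. s < q \<Longrightarrow> Poly_Mapping.lookup (u i) s = Poly_Mapping.lookup (v i) s"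
    "Poly_Mapping.lookup (u i) q < Poly_Mapping.lookup (v i) q"
proof -
  have sums: "(\<Sum>i<N. index_count (w i) r) = (\<Sum>s\<le>r. \<Sum>i<N. Poly_Mapping.lookup (w i) s)" for w r
    unfolding index_count_def by (rule sum.swap)
  have mono: "index_count (w i) r \<le> index_count (w' i) r"
    if w: "\<forall>j<N. \<forall>i\<le>j. precedes (w i) (w j)" and w': "\<forall>j<N. \<forall>i\<le>j. precedes (w' i) (w' j)"
      and "(\<Sum>i<N. index_count (w i) r) \<le> (\<Sum>i<N. index_count (w' i) r)" "i < N" for w w' i r
  proof (rule balanced_sequence_mono[of N "\<lambda>i. index_count (w i) r" "\<lambda>i. index_count (w' i) r"])
    fix i j assume "i \<le> j" "j < N"
    then show "index_count (w j) r \<le> index_count (w i) r \<and> index_count (w i) r \<le> index_count (w j) r + 1"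
      "index_count (w' j) r \<le> index_count (w' i) r \<and> index_count (w' i) r \<le> index_count (w' j) r + 1"
      using w w' by (simp_all add: precedes_def)
  qed fact+
  have same: "index_count (u i) r = index_count (v i) r" if "r < q" "i < N" for i r
  proof -
    have "(\<Sum>i<N. index_count (u i) r) = (\<Sum>i<N. index_count (v i) r)"
      unfolding sums by (rule sum.cong) (use that eq in auto)
    then show ?thesis using mono[OF u v, of r i] mono[OF v u, of r i] that by simp
  qed
  have lookup: "Poly_Mapping.lookup (u i) s = Poly_Mapping.lookup (v i) s" if "s < q" "i < N" for i s
  proof (cases s)
    case 0
    then show ?thesis using same[of 0 i] that by (simp add: index_count_def)
  next
    case (Suc s')
    then show ?thesis using same[of s i] same[of s' i] that by (simp add: index_count_def)
  qed
  obtain i where "i < N" "Poly_Mapping.lookup (u i) q < Poly_Mapping.lookup (v i) q"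
    using less sum_mono[of "{..<N}" "\<lambda>i. Poly_Mapping.lookup (v i) q" "\<lambda>i. Poly_Mapping.lookup (u i) q"]
    by (metis lessThan_iff not_le)
  then show thesis using lookup that by blast
qed

section \<open>The exchange property of the facet ideal\<close>

theorem proposition1p4:
  fixes n d t :: nat
    and \<Delta> \<Gamma> :: "nat set set"
    and I :: "(nat, 'k::field) mpoly set"
    and lt :: "nat monom monom \<Rightarrow> nat monom monom \<Rightarrow> bool"
  assumes "unit_interval_complex n d \<Delta>"
    and "\<Gamma> = independence_complex n \<Delta>"
    and "t \<ge> 1"
    and "I = facet_ideal n (pure_skeleton t \<Gamma>)"
    and "sorting_order I lt"
  shows "l_exchange_property n I lt"
  unfolding l_exchange_property_def
proof (intro allI impI, elim conjE)
  fix N q :: nat and u v :: "nat \<Rightarrow> nat monom"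
  assume gens: "\<forall>k\<in>{1..N}. u k \<in> min_gens I \<and> v k \<in> min_gens I"
    and stu: "standard_monomial (min_gens I) lt (toric_ideal I) (\<Sum>k=1..N. var (u k))"
    and stv: "standard_monomial (min_gens I) lt (toric_ideal I) (\<Sum>k=1..N. var (v k))"
    and q: "1 \<le> q" "q \<le> n - 1"
    and eq: "\<forall>r. 1 \<le> r \<and> r \<le> q - 1 \<longrightarrow>
       Poly_Mapping.lookup (\<Sum>k=1..N. u k) r = Poly_Mapping.lookup (\<Sum>k=1..N. v k) r"
    and less: "Poly_Mapping.lookup (\<Sum>k=1..N. u k) q < Poly_Mapping.lookup (\<Sum>k=1..N. v k) q"
  define B where "B = {F \<in> \<Gamma>. card F = t + 1}"
  have facets: "facets (pure_skeleton t \<Gamma>) = B"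
    using facets_pure_skeleton assms(2) by (simp add: B_def)
  have B: "F \<subseteq> {1..n}" "finite F" "card F = t + 1" if "F \<in> B" for F
    using that independence_complex_finite by (auto simp: B_def assms(2) independence_complex_def)
  have gen_set: "m \<in> squarefree_mon ` B" if "m \<in> min_gens I" for m
    using min_gens_facet_ideal[of "pure_skeleton t \<Gamma>" n] that assms(4) B facets by auto
  have arr: "\<exists>w'. (\<forall>i<N. w' i \<in> w ` {1..N}) \<and>
      (\<forall>f :: nat monom \<Rightarrow> nat. (\<Sum>i<N. f (w' i)) = (\<Sum>k=1..N. f (w k))) \<and>
      (\<forall>j<N. \<forall>i\<le>j. precedes (w' i) (w' j))"
    if wgens: "\<And>k. k \<in> {1..N} \<Longrightarrow> w k \<in> min_gens I"
      and wst: "standard_monomial (min_gens I) lt (toric_ideal I) (\<Sum>k=1..N. var (w k))" for w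
  proof (rule sorted_family_arrangement[of N w n])
    show "precedes (w k) (w l) \<or> precedes (w l) (w k)"
      if "k \<in> {1..N}" "l \<in> {1..N}" "k \<noteq> l" for k l
      by (rule not_unsorted_precedes)
        (rule standard_monomial_sorted[OF assms(5) wst finite_atLeastAtMost wgens that])
    \<comment> \<open>Generators are supported in \<open>{1..n}\<close>, so no index is counted
      beyond \<open>n\<close>.\<close>
    show "index_count (w k) r = index_count (w k) n" if k: "k \<in> {1..N}" and r: "n \<le> r" for k r
    proof -
      obtain F where F: "F \<in> B" "w k = squarefree_mon F"
        using gen_set wgens k by blast
      then have "{i \<in> F. i \<le> r} = {i \<in> F. i \<le> n}" using B(1)[OF F(1)] r by auto
      then show ?thesis using F B(2) by (simp add: index_count_squarefree_mon)
    qed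
  qed blast
  obtain u' where u': "\<And>i. i < N \<Longrightarrow> u' i \<in> u ` {1..N}"
      "\<And>f :: nat monom \<Rightarrow> nat. (\<Sum>i<N. f (u' i)) = (\<Sum>k=1..N. f (u k))"
      "\<forall>j<N. \<forall>i\<le>j. precedes (u' i) (u' j)"
    using arr[of u] gens stu by blast
  obtain v' where v': "\<And>i. i < N \<Longrightarrow> v' i \<in> v ` {1..N}"
      "\<And>f :: nat monom \<Rightarrow> nat. (\<Sum>i<N. f (v' i)) = (\<Sum>k=1..N. f (v k))"
      "\<forall>j<N. \<forall>i\<le>j. precedes (v' i) (v' j)"
    using arr[of v] gens stv by blast
  \<comment> \<open>Cumulative counts start at index 0, whereas the degree hypothesis starts at 1;
    the gap closes because 0 is not a vertex.\<close>
  have zero: "Poly_Mapping.lookup m 0 = 0" if "m \<in> min_gens I" for m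
    using gen_set[OF that] B by (force simp: lookup_squarefree_mon)
  have sums: "(\<Sum>i<N. Poly_Mapping.lookup (u' i) r) = Poly_Mapping.lookup (\<Sum>k=1..N. u k) r"
    "(\<Sum>i<N. Poly_Mapping.lookup (v' i) r) = Poly_Mapping.lookup (\<Sum>k=1..N. v k) r" for r
    unfolding lookup_sum_monom
    by (rule u'(2)[of "\<lambda>m. Poly_Mapping.lookup m r"], rule v'(2)[of "\<lambda>m. Poly_Mapping.lookup m r"])
  obtain i where i: "i < N"
    "\<And>s. s < q \<Longrightarrow> Poly_Mapping.lookup (u' i) s = Poly_Mapping.lookup (v' i) s"
    "Poly_Mapping.lookup (u' i) q < Poly_Mapping.lookup (v' i) q"
  proof (rule sorted_families_first_difference[of N u' v' q])
    show "(\<Sum>i<N. Poly_Mapping.lookup (u' i) r) = (\<Sum>i<N. Poly_Mapping.lookup (v' i) r)"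
      if "r < q" for r
    proof (cases "r = 0")
      case True
      then show ?thesis using gens zero by (simp add: sums lookup_sum_monom)
    next
      case False
      then show ?thesis using eq that by (simp add: sums)
    qed
    show "(\<Sum>i<N. Poly_Mapping.lookup (u' i) q) < (\<Sum>i<N. Poly_Mapping.lookup (v' i) q)"
      using less by (simp only: sums)
  qed (rule u'(3), rule v'(3), rule that)
  obtain k where k: "k \<in> {1..N}" "u' i = u k" using u'(1)[OF i(1)] by auto
  obtain l where l: "l \<in> {1..N}" "v' i = v l" using v'(1)[OF i(1)] by auto
  have "u' i \<in> squarefree_mon ` B" by (rule gen_set) (use k gens in simp)
  then obtain F where F: "F \<in> B" "u' i = squarefree_mon F" by (rule imageE)
  have "v' i \<in> squarefree_mon ` B" by (rule gen_set) (use l gens in simp)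
  then obtain G where G: "G \<in> B" "v' i = squarefree_mon G" by (rule imageE)
  have below: "s \<in> F \<longleftrightarrow> s \<in> G" if "s < q" for s
    using i(2)[OF that] F G B(2) by (auto simp: lookup_squarefree_mon split: if_splits)
  have qFG: "q \<in> G" "q \<notin> F"
    using i(3) F G B(2) by (auto simp: lookup_squarefree_mon split: if_splits)
  \<comment> \<open>Otherwise \<open>F\<close> would be contained in \<open>G\<close>, properly
    because of \<open>q\<close>, although both have \<open>t + 1\<close> elements.\<close>
  have "\<exists>j. j \<in> F \<and> q < j"
  proof (rule ccontr)
    assume "\<nexists>j. j \<in> F \<and> q < j"
    then have "s \<in> G" if "s \<in> F" for s
      using below[of s] qFG that by (metis linorder_neqE_nat)
    then have "F \<subset> G" using qFG by auto
    then show False using psubset_card_mono[of G F] B F G by auto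
  qed
  then obtain j where j: "j \<in> F" "q < j" "\<And>s. s \<in> F \<Longrightarrow> q < s \<Longrightarrow> j \<le> s"
    using exists_least_iff[of "\<lambda>j. j \<in> F \<and> q < j"] by (metis not_le)
  have "insert q (F - {j}) \<in> \<Gamma>"
    using independence_complex_exchange[OF assms(1), of F G q j] F G below qFG j
    by (simp add: B_def assms(2))
  moreover have "card (insert q (F - {j})) = t + 1"
    using B[OF F(1)] qFG j by (auto simp: card_insert_if)
  ultimately have in_I: "mon_poly (squarefree_mon (insert q (F - {j}))) \<in> I"
    unfolding assms(4) by (intro squarefree_mon_in_facet_ideal) (simp add: facets B_def)
  have uk: "u k = var j + squarefree_mon (F - {j})"
    using k F j B(2)[OF F(1)] by (simp add: sum.remove)
  \<comment> \<open>Subtraction of exponent vectors is truncated; it is exact here because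
    \<open>var j\<close> is a summand of \<open>u k\<close>.\<close>
  have "squarefree_mon (insert q (F - {j})) = var q + u k - var j"
  proof -
    have "var q + u k - var j = (var q + squarefree_mon (F - {j})) + var j - var j"
      by (simp add: uk ac_simps)
    also have "\<dots> = var q + squarefree_mon (F - {j})" by (rule add_diff_cancel_right')
    also have "\<dots> = squarefree_mon (insert q (F - {j}))"
      using B(2)[OF F(1)] qFG by (simp add: sum.insert)
    finally show ?thesis by simp
  qed
  then have "mon_poly (var q + u k - var j) \<in> I" using in_I by simp
  moreover have "mon_dvd (var j) (u k)" unfolding mon_dvd_def using uk by blast
  moreover have "j \<le> n" using j(1) B(1)[OF F(1)] by auto
  ultimately show "\<exists>k\<in>{1..N}. \<exists>j. q < j \<and> j \<le> n \<and> mon_dvd (var j) (u k) \<and>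
      mon_poly (var q + u k - var j) \<in> I"
    using k(1) j(2) by metis
qed

end
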